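(* Let $X$ be a separable Banach space. Then $C(X)<\omega_1$ if and only if $X$ has the Slice Point of Continuity Property (Slice PCP).
   Context: All Banach spaces are real; $B_X$ is the closed unit ball; $\omega_1$ is the first uncountable ordinal. **Index $C$.** For $C\subset X$ and $\varepsilon>0$ let $\sigma_\varepsilon^1(C)=C\setminus\bigcup\{V: V\text{ weakly open in }X,\ \operatorname{diam}(V\cap C)<\varepsilon\}$. For a closed bounded convex set $C\subset X$ let $\gamma_\varepsilon^1(C)$ be the (norm-)closed convex hull of $\sigma_\varepsilon^1(C)$ (empty if $\sigma_\varepsilon^1(C)=\emptyset$), $\gamma_\varepsilon^0(C)=C$, $\gamma_\varepsilon^{\alpha+1}(C)=\gamma_\varepsilon^1(\gamma_\varepsilon^\alpha(C))$, and $\gamma_\varepsilon^\alpha(C)=\bigcap_{\beta<\alpha}\gamma_\varepsilon^\beta(C)$ for $\alpha$ a limit ordinal. Put $C(X,\varepsilon)=\inf\{\alpha:\gamma_\varepsilon^\alpha(B_X)=\emptyset\}$ (with $\inf\emptyset=\infty$, and $\alpha<\infty$ for every ordinal $\alpha$) and $C(X)=\sup_{\varepsilon>0}C(X,\varepsilon)$. **Slice PCP.** An open half-space of $X$ is a set $\{x\in X: x^*(x)>a\}$ with $x^*\in X^*$, $a\in\mathbb{R}$. $X$ has the Slice PCP if for any nonempty bounded subset $A$ of $X$ and any $\varepsilon>0$ there exists an open half-space $S$ such that $S\cap A\ne\emptyset$ and any $x\in S\cap A$ admits a weak neighborhood $V$ satisfying $\operatorname{diam}(V\cap A)<\varepsilon$.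 *)

theory Defs
  imports "HOL-Analysis.Analysis"
begin

section \<open>Ordinals\<close>

text \<open>
  Elements of \<open>'b ordinal\<close> are the isomorphism classes of well-orders whose field is a
  subset of the type \<^typ>\<open>'b\<close>. They form the initial segment of the ordinals consisting of all
  ordinals of cardinality at most that of \<^typ>\<open>'b\<close>.
\<close>

quotient_type 'b ordinal = "'b rel" / partial: "\<lambda>r s. (r, s) \<in> (ordIso :: ('b rel \<times> 'b rel) set)"
proof (rule part_equivpI)
  have "Well_order ({} :: 'b rel)"
    by (simp add: Field_def)
  then show "\<exists>r::'b rel. (r, r) \<in> ordIso"
    using ordIso_reflexive by blast
  show "symp (\<lambda>r s. (r, s) \<in> (ordIso :: ('b rel \<times> 'b rel) set))"
    by (auto intro!: sympI ordIso_symmetric)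
  show "transp (\<lambda>r s. (r, s) \<in> (ordIso :: ('b rel \<times> 'b rel) set))"
    by (auto intro!: transpI intro: ordIso_transitive)
qed

instantiation ordinal :: (type) wellorder
begin

lift_definition less_eq_ordinal :: "'b ordinal \<Rightarrow> 'b ordinal \<Rightarrow> bool"
  is "\<lambda>r s. (r, s) \<in> ordLeq"
  by (meson ordIso_ordLeq_trans ordLeq_ordIso_trans ordIso_symmetric)

lift_definition less_ordinal :: "'b ordinal \<Rightarrow> 'b ordinal \<Rightarrow> bool"
  is "\<lambda>r s. (r, s) \<in> ordLess"
  by (meson ordIso_ordLess_trans ordLess_ordIso_trans ordIso_symmetric)

instance
proof
  fix x y z :: "'b ordinal"
  have WO: "\<And>r s :: 'b rel. (r, s) \<in> ordIso \<Longrightarrow> Well_order r \<and> Well_order s"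
    by (auto simp: ordIso_def)
  show "(x < y) = (x \<le> y \<and> \<not> y \<le> x)"
    by transfer (metis WO not_ordLess_iff_ordLeq ordLess_imp_ordLeq)
  show "x \<le> x"
    by transfer (metis WO ordLeq_reflexive)
  show "x \<le> y \<Longrightarrow> y \<le> z \<Longrightarrow> x \<le> z"
    by transfer (metis ordLeq_transitive)
  show "x \<le> y \<Longrightarrow> y \<le> x \<Longrightarrow> x = y"
    by transfer (metis ordIso_iff_ordLeq)
  show "x \<le> y \<or> y \<le> x"
    by transfer (metis WO ordLeq_total)
next
  fix P :: "'b ordinal \<Rightarrow> bool" and a :: "'b ordinal"
  assume step: "\<And>x. (\<And>y. y < x \<Longrightarrow> P y) \<Longrightarrow> P x"
  have *: "\<forall>x. rep_ordinal x = r \<longrightarrow> P x" for r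
  proof (induction r rule: wf_induct[OF wf_ordLess])
    case (1 r)
    show ?case
    proof (intro allI impI)
      fix x :: "'b ordinal" assume r: "rep_ordinal x = r"
      show "P x"
      proof (rule step)
        fix y assume "y < x"
        then have "(rep_ordinal y, rep_ordinal x) \<in> ordLess"
          by (simp add: less_ordinal.rep_eq)
        with 1 r show "P y" by blast
      qed
    qed
  qed
  then show "P a" by blast
qed

end

text \<open>
  The first uncountable ordinal. The factor \<^typ>\<open>real\<close> makes the carrier uncountable,
  which guarantees that the ordinal exists in the type.
\<close>

definition omega_one :: "('a \<times> real) ordinal" where
  "omega_one = (LEAST \<alpha>. uncountable {..<\<alpha>})"

lemma ex_uncountable_ordinal: "\<exists>\<alpha> :: ('a \<times> real) ordinal. uncountable {..<\<alpha>}"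
proof -
  obtain r :: "('a \<times> real) rel" where r: "well_order_on UNIV r"
    using well_order_on by blast
  then have WO: "Well_order r" and F: "Field r = UNIV"
    using well_order_on_Field well_order_on_Well_order by blast+
  interpret W: wo_rel r
    using WO by (simp add: wo_rel_def)
  let ?s = "\<lambda>x. Restr r (underS r x)"
  let ?f = "\<lambda>x. abs_ordinal (?s x)"
  have WOs: "Well_order (?s x)" for x
    using WO Well_order_Restr by blast
  have refl: "(s, s) \<in> ordIso" if "Well_order s" for s :: "('a \<times> real) rel"
    using that ordIso_reflexive by blast
  have less: "abs_ordinal s < abs_ordinal t \<longleftrightarrow> (s, t) \<in> ordLess"
    if "Well_order s" "Well_order t" for s t :: "('a \<times> real) rel"
    using that by (simp add: less_ordinal.abs_eq refl)
  have below: "?f x < abs_ordinal r" for x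
    using less[OF WOs WO] underS_Restr_ordLess[OF WO] F by auto
  have mono: "?f x < ?f y" if "x \<noteq> y" "(x, y) \<in> r" for x y
  proof -
    have sub: "underS r x \<subset> underS r y"
      using that W.ANTISYM W.TRANS unfolding underS_def antisym_def trans_def by blast
    have "(?s x, ?s y) \<in> ordLess"
      using ofilter_subset_ordLess[OF WO W.underS_ofilter W.underS_ofilter] sub by blast
    then show ?thesis
      using less[OF WOs WOs] by blast
  qed
  have "inj ?f"
  proof (rule injI, rule ccontr)
    fix x y assume "?f x = ?f y" "x \<noteq> y"
    moreover have "(x, y) \<in> r \<or> (y, x) \<in> r"
      using W.TOTALS F by blast
    ultimately show False
      using mono by (metis less_irrefl)
  qed
  have "uncountable (UNIV :: ('a \<times> real) set)"
  proof
    assume "countable (UNIV :: ('a \<times> real) set)"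
    then have "countable (range (snd :: 'a \<times> real \<Rightarrow> real))"
      by (rule countable_image)
    then show False
      using uncountable_UNIV_real by simp
  qed
  with \<open>inj ?f\<close> have "uncountable (range ?f)"
    using countable_image_inj_on by blast
  moreover have "range ?f \<subseteq> {..<abs_ordinal r}"
    using below by auto
  ultimately show ?thesis
    using countable_subset by blast
qed

lemma uncountable_below_omega_one: "uncountable {..<omega_one}"
  unfolding omega_one_def by (rule LeastI_ex[OF ex_uncountable_ordinal])

lemma less_omega_one_iff: "\<alpha> < omega_one \<longleftrightarrow> countable {..<\<alpha>}"
proof
  show "countable {..<\<alpha>}" if "\<alpha> < omega_one"
    using that not_less_Least unfolding omega_one_def by blast
  show "\<alpha> < omega_one" if "countable {..<\<alpha>}"
  proof (rule ccontr)
    assume "\<not> \<alpha> < omega_one"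
    then have "{..<omega_one} \<subseteq> {..<\<alpha>}" by auto
    with that show False
      using countable_subset uncountable_below_omega_one by blast
  qed
qed


section \<open>Adjoining infinity on top\<close>

datatype 'o with_infty = Ord 'o | Infty

instantiation with_infty :: (wellorder) complete_linorder
begin

fun less_eq_with_infty :: "'a with_infty \<Rightarrow> 'a with_infty \<Rightarrow> bool" where
  "less_eq_with_infty x Infty \<longleftrightarrow> True"
| "less_eq_with_infty Infty (Ord b) \<longleftrightarrow> False"
| "less_eq_with_infty (Ord a) (Ord b) \<longleftrightarrow> a \<le> b"

definition less_with_infty :: "'a with_infty \<Rightarrow> 'a with_infty \<Rightarrow> bool" where
  "less_with_infty x y \<longleftrightarrow> x \<le> y \<and> \<not> y \<le> x"

definition Inf_with_infty :: "'a with_infty set \<Rightarrow> 'a with_infty" where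
  "Inf S = (if Ord -` S = {} then Infty else Ord (LEAST a. Ord a \<in> S))"

definition Sup_with_infty :: "'a with_infty set \<Rightarrow> 'a with_infty" where
  "Sup S = Inf {u :: 'a with_infty. \<forall>x\<in>S. x \<le> u}"

definition bot_with_infty :: "'a with_infty" where "bot = Inf (UNIV :: 'a with_infty set)"
definition top_with_infty :: "'a with_infty" where "top = Infty"
definition inf_with_infty :: "'a with_infty \<Rightarrow> 'a with_infty \<Rightarrow> 'a with_infty" where
  "inf x y = (if (x :: 'a with_infty) \<le> y then x else y)"
definition sup_with_infty :: "'a with_infty \<Rightarrow> 'a with_infty \<Rightarrow> 'a with_infty" where
  "sup x y = (if (x :: 'a with_infty) \<le> y then y else x)"

instance
proof
  fix x y z :: "'a with_infty" and A :: "'a with_infty set"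
  show "(x < y) = (x \<le> y \<and> \<not> y \<le> x)" by (fact less_with_infty_def)
  show refl: "x \<le> x" for x :: "'a with_infty" by (cases x) auto
  show trans: "x \<le> y \<Longrightarrow> y \<le> z \<Longrightarrow> x \<le> z" for x y z :: "'a with_infty"
    by (cases x; cases y; cases z) auto
  show "x \<le> y \<Longrightarrow> y \<le> x \<Longrightarrow> x = y" by (cases x; cases y) auto
  show tot: "x \<le> y \<or> y \<le> x" for x y :: "'a with_infty" by (cases x; cases y) auto
  show "inf x y \<le> x" "inf x y \<le> y" "x \<le> y \<Longrightarrow> x \<le> z \<Longrightarrow> x \<le> inf y z"
    "x \<le> sup x y" "y \<le> sup x y" "y \<le> x \<Longrightarrow> z \<le> x \<Longrightarrow> sup y z \<le> x"
    using tot refl by (auto simp: inf_with_infty_def sup_with_infty_def)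
  have lower: "Inf A \<le> x" if "x \<in> A" for x and A :: "'a with_infty set"
    using that by (cases x) (auto simp: Inf_with_infty_def intro: Least_le)
  have greatest: "z \<le> Inf A" if "\<And>x. x \<in> A \<Longrightarrow> z \<le> x" for z and A :: "'a with_infty set"
  proof (cases "Ord -` A = {}")
    case False
    then have "\<exists>a. Ord a \<in> A" by auto
    then have "Ord (LEAST a. Ord a \<in> A) \<in> A" by (rule LeastI_ex)
    with False that show ?thesis by (simp add: Inf_with_infty_def)
  qed (simp add: Inf_with_infty_def)
  show "x \<in> A \<Longrightarrow> Inf A \<le> x" by (fact lower)
  show "(\<And>x. x \<in> A \<Longrightarrow> z \<le> x) \<Longrightarrow> z \<le> Inf A" by (fact greatest)
  show "x \<in> A \<Longrightarrow> x \<le> Sup A"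
    unfolding Sup_with_infty_def by (rule greatest) blast
  show "(\<And>x. x \<in> A \<Longrightarrow> x \<le> z) \<Longrightarrow> Sup A \<le> z"
    unfolding Sup_with_infty_def by (rule lower) blast
  show "Inf {} = (top :: 'a with_infty)"
    by (simp add: Inf_with_infty_def top_with_infty_def)
  show "Sup {} = (bot :: 'a with_infty)"
    by (simp add: Sup_with_infty_def bot_with_infty_def)
qed

end

lemma Ord_less_iff [simp]: "Ord a < Ord b \<longleftrightarrow> a < b"
  by (auto simp: less_with_infty_def)

lemma Ord_less_Infty [simp]: "Ord a < Infty"
  by (simp add: less_with_infty_def)


section \<open>The index and the Slice Point of Continuity Property\<close>

definition weak_top :: "'a::real_normed_vector topology" where
  "weak_top = topology_generated_by
     {f -` U | (f :: 'a \<Rightarrow> real) U. bounded_linear f \<and> open U}"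

text \<open>
  An unbounded set has infinite diameter, whereas \<^const>\<open>diameter\<close> is unspecified on it;
  hence the explicit boundedness requirement.
\<close>

definition sigma1 :: "real \<Rightarrow> 'a::real_normed_vector set \<Rightarrow> 'a set" where
  "sigma1 \<epsilon> C = C - \<Union>{V. openin weak_top V \<and> bounded (V \<inter> C) \<and> diameter (V \<inter> C) < \<epsilon>}"

definition gamma1 :: "real \<Rightarrow> 'a::real_normed_vector set \<Rightarrow> 'a set" where
  "gamma1 \<epsilon> C = closure (convex hull (sigma1 \<epsilon> C))"

definition is_zero_ord :: "'o::wellorder \<Rightarrow> bool" where
  "is_zero_ord \<alpha> \<longleftrightarrow> (\<forall>\<beta>. \<alpha> \<le> \<beta>)"

definition is_succ_of :: "'o::wellorder \<Rightarrow> 'o \<Rightarrow> bool" where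
  "is_succ_of \<alpha> \<beta> \<longleftrightarrow> \<beta> < \<alpha> \<and> (\<forall>\<delta>. \<beta> < \<delta> \<longrightarrow> \<alpha> \<le> \<delta>)"

lemma is_succ_of_unique: "is_succ_of \<alpha> \<beta> \<Longrightarrow> is_succ_of \<alpha> \<beta>' \<Longrightarrow> \<beta> = \<beta>'"
  unfolding is_succ_of_def by (metis leD linorder_neqE)

lemma is_succ_of_The: "is_succ_of \<alpha> \<beta> \<Longrightarrow> (THE \<beta>. is_succ_of \<alpha> \<beta>) = \<beta>"
  using is_succ_of_unique by blast

function gamma_iter :: "real \<Rightarrow> 'a::real_normed_vector set \<Rightarrow> 'o::wellorder \<Rightarrow> 'a set" where
  "gamma_iter \<epsilon> C \<alpha> =
     (if is_zero_ord \<alpha> then C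
      else if \<exists>\<beta>. is_succ_of \<alpha> \<beta> then gamma1 \<epsilon> (gamma_iter \<epsilon> C (THE \<beta>. is_succ_of \<alpha> \<beta>))
      else (\<Inter>\<beta>\<in>{..<\<alpha>}. gamma_iter \<epsilon> C \<beta>))"
  by pat_completeness auto
termination
proof (relation "inv_image {(\<beta>, \<alpha>). \<beta> < \<alpha>} (snd \<circ> snd)")
  show "wf (inv_image {(\<beta>, \<alpha> :: 'o::wellorder). \<beta> < \<alpha>} (snd \<circ> snd))"
    by (intro wf_inv_image wf)
next
  fix \<epsilon> and C :: "'a::real_normed_vector set" and \<alpha> :: "'o::wellorder"
  assume "\<exists>\<beta>. is_succ_of \<alpha> \<beta>"
  then show "((\<epsilon>, C, THE \<beta>. is_succ_of \<alpha> \<beta>), \<epsilon>, C, \<alpha>) \<in> inv_image {(\<beta>, \<alpha>). \<beta> < \<alpha>} (snd \<circ> snd)"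
    by (auto simp: is_succ_of_The) (simp add: is_succ_of_def)
qed auto

declare gamma_iter.simps [simp del]

lemma gamma_iter_zero: "is_zero_ord \<alpha> \<Longrightarrow> gamma_iter \<epsilon> C \<alpha> = C"
  by (simp add: gamma_iter.simps)

lemma gamma_iter_succ:
  assumes "is_succ_of \<alpha> \<beta>"
  shows "gamma_iter \<epsilon> C \<alpha> = gamma1 \<epsilon> (gamma_iter \<epsilon> C \<beta>)"
proof -
  have "\<not> is_zero_ord \<alpha>"
    using assms unfolding is_zero_ord_def is_succ_of_def by (meson leD)
  with assms show ?thesis
    by (subst gamma_iter.simps) (auto simp: is_succ_of_The)
qed

lemma gamma_iter_limit:
  assumes "\<not> is_zero_ord \<alpha>" "\<nexists>\<beta>. is_succ_of \<alpha> \<beta>"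
  shows "gamma_iter \<epsilon> C \<alpha> = (\<Inter>\<beta>\<in>{..<\<alpha>}. gamma_iter \<epsilon> C \<beta>)"
  using assms by (subst gamma_iter.simps) auto

text \<open>
  The ordinals available here are those of cardinality at most that of \<^typ>\<open>'a \<times> real\<close>.
  This loses nothing: the iteration is a decreasing sequence of subsets of \<^typ>\<open>'a\<close>, so it is
  stationary from some such ordinal on, and the supremum over \<open>\<epsilon>\<close> is again such an
  ordinal or infinity.
\<close>

definition C_index_eps :: "'a::real_normed_vector itself \<Rightarrow> real \<Rightarrow> ('a \<times> real) ordinal with_infty" where
  "C_index_eps _ \<epsilon> = Inf (Ord ` {\<alpha>. gamma_iter \<epsilon> (cball (0::'a) 1) \<alpha> = {}})"

definition C_index :: "'a::real_normed_vector itself \<Rightarrow> ('a \<times> real) ordinal with_infty" where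
  "C_index T = (SUP \<epsilon>\<in>{0<..}. C_index_eps T \<epsilon>)"

definition open_half_space :: "'a::real_normed_vector set \<Rightarrow> bool" where
  "open_half_space S \<longleftrightarrow> (\<exists>(f :: 'a \<Rightarrow> real) a. bounded_linear f \<and> S = {x. f x > a})"

definition weak_nhd :: "'a::real_normed_vector \<Rightarrow> 'a set \<Rightarrow> bool" where
  "weak_nhd x V \<longleftrightarrow> (\<exists>U. openin weak_top U \<and> x \<in> U \<and> U \<subseteq> V)"

definition slice_PCP :: "'a::real_normed_vector itself \<Rightarrow> bool" where
  "slice_PCP _ \<longleftrightarrow>
     (\<forall>A :: 'a set. A \<noteq> {} \<longrightarrow> bounded A \<longrightarrow> (\<forall>\<epsilon>>0.
        \<exists>S. open_half_space S \<and> S \<inter> A \<noteq> {} \<and>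
          (\<forall>x\<in>S \<inter> A. \<exists>V. weak_nhd x V \<and> diameter (V \<inter> A) < \<epsilon>)))"

end

theory Submission
  imports Defs
begin

text \<open>
  Both implications compare \<open>\<gamma>\<^sup>1\<close> with open half-spaces: \<open>\<gamma>\<^sup>1 C\<close> is the intersection of the closed
  half-spaces containing \<open>\<sigma>\<^sup>1 C\<close>, so \<open>\<gamma>\<^sup>1 C\<close> misses a point of \<open>C\<close> exactly when some open
  half-space meets \<open>C\<close> and avoids \<open>\<sigma>\<^sup>1 C\<close>, that is, meets \<open>C\<close> only in points with small weak
  neighbourhoods.

  If the derivation kills the unit ball, a nonempty set \<open>A\<close> in the ball is lost at some first stage.
  That stage is a successor, so \<open>A \<subseteq> C\<close> but some \<open>a \<in> A\<close> lies outside \<open>\<gamma>\<^sup>1 C\<close>, where \<open>C\<close>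
  is the preceding derived set. A half-space separating \<open>a\<close> from \<open>\<gamma>\<^sup>1 C\<close> witnesses the Slice PCP
  for \<open>A\<close>, because weak neighbourhoods that cut a small piece from \<open>C\<close> cut a small piece from
  \<open>A\<close>. General bounded sets are reduced to this case by scaling. The separation is the
  Hahn--Banach theorem, proved below through minimal sublinear functionals
  (\<open>minimal_sublinear_linear\<close>, \<open>separate_point_closed_convex\<close>).

  Conversely, under the Slice PCP every nonempty derived set has a strictly smaller successor. A
  separable metric space has no uncountable strictly decreasing well-ordered family of closed sets
  (\<open>countable_right_separated\<close>), so for each \<open>\<epsilon>\<close> the derived sets vanish before \<open>\<omega>\<^sub>1\<close>. Derived
  sets grow as \<open>\<epsilon>\<close> shrinks, so the supremum over \<open>\<epsilon>\<close> is reached along \<open>\<epsilon> = 1/n\<close>, and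
  countably many countable ordinals are bounded by a countable one.
\<close>


section \<open>Separation of a point from a closed convex set\<close>

definition sublinear :: "('a::real_vector \<Rightarrow> real) \<Rightarrow> bool" where
  "sublinear p \<longleftrightarrow>
     (\<forall>x y. p (x + y) \<le> p x + p y) \<and> (\<forall>t x. 0 \<le> t \<longrightarrow> p (t *\<^sub>R x) \<le> t * p x)"

lemma sublinearI:
  assumes "\<And>x y. p (x + y) \<le> p x + p y" "\<And>t x. 0 \<le> t \<Longrightarrow> p (t *\<^sub>R x) \<le> t * p x"
  shows "sublinear p"
  using assms unfolding sublinear_def by blast

lemma sublinear_add: "sublinear p \<Longrightarrow> p (x + y) \<le> p x + p y"
  and sublinear_scaleR_le: "sublinear p \<Longrightarrow> 0 \<le> t \<Longrightarrow> p (t *\<^sub>R x) \<le> t * p x"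
  unfolding sublinear_def by blast+

lemma sublinear_zero: "sublinear p \<Longrightarrow> p 0 = 0"
  using sublinear_add[of p 0 0] sublinear_scaleR_le[of p 0 0] by simp

lemma sublinear_scaleR:
  assumes "sublinear p" "0 \<le> t"
  shows "p (t *\<^sub>R x) = t * p x"
proof (cases "t = 0")
  case False
  with assms have "p (inverse t *\<^sub>R (t *\<^sub>R x)) \<le> inverse t * p (t *\<^sub>R x)"
    by (intro sublinear_scaleR_le) auto
  with False assms have "t * p x \<le> p (t *\<^sub>R x)"
    by (simp add: field_simps)
  with sublinear_scaleR_le[OF assms] show ?thesis
    by (meson order_antisym)
qed (simp add: sublinear_zero assms)

lemma sublinear_minus_le: "sublinear p \<Longrightarrow> - p (- x) \<le> p x"
  using sublinear_add[of p x "- x"] sublinear_zero[of p] by simp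

lemma sublinear_norm: "sublinear (norm :: 'a::real_normed_vector \<Rightarrow> real)"
  by (intro sublinearI) (auto intro: norm_triangle_ineq)

text \<open>
  The pointwise infimum of a chain stays finite, since each \<open>p\<close> in the chain satisfies
  \<open>p x \<ge> - p (- x) \<ge> - q (- x)\<close>, so Zorn's lemma applies.
\<close>

lemma minimal_sublinear_exists:
  fixes q :: "'a::real_vector \<Rightarrow> real"
  assumes q: "sublinear q"
  obtains m where "sublinear m" "m \<le> q" "\<And>p. sublinear p \<Longrightarrow> p \<le> m \<Longrightarrow> p = m"
proof -
  let ?A = "{p. sublinear p \<and> p \<le> q}"
  let ?P = "\<lambda>p p' :: 'a \<Rightarrow> real. p' \<le> p"
  have po: "partial_order_on ?A (relation_of ?P ?A)"
    by (rule partial_order_on_relation_ofI) (auto intro: order_trans)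
  have "\<exists>u\<in>?A. \<forall>p\<in>C. ?P p u" if C: "C \<in> Chains (relation_of ?P ?A)" for C
  proof (cases "C = {}")
    case True
    with q show ?thesis by blast
  next
    case ne: False
    have sub: "sublinear p" and le: "\<And>x. p x \<le> q x" if "p \<in> C" for p
      using that C by (auto simp: Chains_def relation_of_def le_fun_def)
    have chain: "p \<le> p' \<or> p' \<le> p" if "p \<in> C" "p' \<in> C" for p p'
      using that C by (auto simp: Chains_def relation_of_def)
    define u where "u x = (INF p\<in>C. p x)" for x
    have "- q (- x) \<le> p x" if "p \<in> C" for p x
      using sublinear_minus_le[OF sub[OF that], of x] le[OF that, of "- x"] by linarith
    then have bdd: "bdd_below ((\<lambda>p. p x) ` C)" for x
      by (rule bdd_belowI2)
    have u_le: "u x \<le> p x" if "p \<in> C" for p x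
      unfolding u_def using bdd that by (rule cINF_lower)
    have u_ge: "c \<le> u x" if "\<And>p. p \<in> C \<Longrightarrow> c \<le> p x" for c x
      unfolding u_def using ne that by (rule cINF_greatest)
    have "sublinear u"
    proof (rule sublinearI)
      fix x y
      have "u (x + y) - p x \<le> p' y" if p: "p \<in> C" and p': "p' \<in> C" for p p'
      proof -
        obtain r where r: "r \<in> C" "r \<le> p" "r \<le> p'"
          using chain[OF p p'] p p' by blast
        have "u (x + y) \<le> r (x + y)" by (rule u_le[OF r(1)])
        also have "\<dots> \<le> r x + r y" by (rule sublinear_add[OF sub[OF r(1)]])
        also have "\<dots> \<le> p x + p' y" using r by (simp add: le_fun_def add_mono)
        finally show ?thesis by simp
      qed
      then have "u (x + y) - p x \<le> u y" if "p \<in> C" for p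
        using that by (intro u_ge) blast
      then have "u (x + y) - u y \<le> u x"
        by (intro u_ge) (simp add: diff_le_eq add.commute)
      then show "u (x + y) \<le> u x + u y" by simp
    next
      fix t :: real and x
      assume t: "0 \<le> t"
      show "u (t *\<^sub>R x) \<le> t * u x"
      proof (cases "t = 0")
        case True
        obtain p where "p \<in> C" using ne by blast
        with u_le[of p 0] sublinear_zero[OF sub[of p]] True show ?thesis by simp
      next
        case False
        with t have pos: "0 < t" by simp
        have "u (t *\<^sub>R x) / t \<le> u x"
        proof (rule u_ge)
          fix p assume p: "p \<in> C"
          show "u (t *\<^sub>R x) / t \<le> p x"
            using u_le[OF p, of "t *\<^sub>R x"] sublinear_scaleR_le[OF sub[OF p] t, of x] pos
            by (simp add: field_simps)
        qed
        with pos show ?thesis by (simp add: field_simps)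
      qed
    qed
    moreover have "u \<le> q"
      using ne u_le le by (meson all_not_in_conv le_funI order_trans)
    ultimately show ?thesis
      using u_le by (auto simp: le_fun_def)
  qed
  from predicate_Zorn[OF po this] obtain m where
    "m \<in> ?A" and min: "\<forall>p\<in>?A. p \<le> m \<longrightarrow> p = m" by blast
  moreover have "p = m" if "sublinear p" "p \<le> m" for p
    using that min \<open>m \<in> ?A\<close> by auto
  ultimately show ?thesis using that by blast
qed

text \<open>
  The infimum of \<open>q (x + t c) - t d\<close> over \<open>t \<ge> 0\<close> and \<open>c \<in> C\<close> is the largest sublinear
  functional \<open>p \<le> q\<close> with \<open>p (- c) \<le> - d\<close> on the convex set \<open>C\<close>. It serves twice: with a
  singleton \<open>C\<close> it shows that minimal sublinear functionals are odd, and with a general \<open>C\<close> it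
  makes a linear functional below \<open>q\<close> keep the lower bound \<open>d\<close> of \<open>q\<close> on \<open>C\<close>.
\<close>

lemma sublinear_push_down:
  fixes q :: "'a::real_vector \<Rightarrow> real"
  assumes q: "sublinear q" and "convex C" "C \<noteq> {}" and d: "\<And>c. c \<in> C \<Longrightarrow> d \<le> q c"
  obtains p where "sublinear p" "p \<le> q" "\<And>c. c \<in> C \<Longrightarrow> p (- c) \<le> - d"
proof -
  define I where "I = {0::real..} \<times> C"
  define F where "F x = (\<lambda>(t, c). q (x + t *\<^sub>R c) - t * d)" for x
  define p where "p x = (INF i\<in>I. F x i)" for x
  have ne: "I \<noteq> {}" using \<open>C \<noteq> {}\<close> by (auto simp: I_def)
  have "- q (- x) \<le> F x i" if "i \<in> I" for x i
  proof -
    obtain t c where i: "i = (t, c)" "0 \<le> t" "c \<in> C" using \<open>i \<in> I\<close> by (auto simp: I_def)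
    have "t * d \<le> t * q c" using i d by (simp add: mult_left_mono)
    also have "\<dots> = q (- x + (x + t *\<^sub>R c))" using sublinear_scaleR[OF q] i by simp
    also have "\<dots> \<le> q (- x) + q (x + t *\<^sub>R c)" by (rule sublinear_add[OF q])
    finally show ?thesis by (simp add: F_def i)
  qed
  then have bdd: "bdd_below (F x ` I)" for x
    by (rule bdd_belowI2)
  have p_le: "p x \<le> q (x + t *\<^sub>R c) - t * d" if "0 \<le> t" "c \<in> C" for x t c
  proof -
    have "p x \<le> F x (t, c)"
      unfolding p_def using bdd by (rule cINF_lower) (use that in \<open>simp add: I_def\<close>)
    then show ?thesis by (simp add: F_def)
  qed
  have p_ge: "b \<le> p x" if "\<And>t c. 0 \<le> t \<Longrightarrow> c \<in> C \<Longrightarrow> b \<le> q (x + t *\<^sub>R c) - t * d" for b x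
    unfolding p_def using ne by (rule cINF_greatest) (use that in \<open>auto simp: I_def F_def\<close>)
  obtain c0 where c0: "c0 \<in> C" using \<open>C \<noteq> {}\<close> by blast
  have "sublinear p"
  proof (rule sublinearI)
    fix x y
    have "p (x + y) \<le> (q (x + s *\<^sub>R b) - s * d) + (q (y + t *\<^sub>R c) - t * d)"
      if st: "0 \<le> s" "0 \<le> t" and bc: "b \<in> C" "c \<in> C" for s t b c
    proof -
      \<comment> \<open>Convexity of \<open>C\<close> turns the sum of the two perturbations into a single one.\<close>
      obtain e where e: "e \<in> C" "(s + t) *\<^sub>R e = s *\<^sub>R b + t *\<^sub>R c"
      proof (cases "s + t = 0")
        case True
        with st have "s = 0" "t = 0" by auto
        with that c0 show ?thesis by auto
      next
        case False
        let ?e = "(s / (s + t)) *\<^sub>R b + (t / (s + t)) *\<^sub>R c"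
        have "?e \<in> C"
          using \<open>convex C\<close> bc st False by (intro convexD) (auto simp: add_divide_distrib[symmetric])
        moreover have "(s + t) *\<^sub>R ?e = s *\<^sub>R b + t *\<^sub>R c"
          using False by (simp add: scaleR_add_right)
        ultimately show ?thesis by (rule that)
      qed
      have "p (x + y) \<le> q (x + y + (s + t) *\<^sub>R e) - (s + t) * d"
        using st e by (intro p_le) auto
      also have "x + y + (s + t) *\<^sub>R e = (x + s *\<^sub>R b) + (y + t *\<^sub>R c)"
        by (simp add: e)
      also have "q \<dots> \<le> q (x + s *\<^sub>R b) + q (y + t *\<^sub>R c)"
        by (rule sublinear_add[OF q])
      finally show ?thesis by (simp add: algebra_simps)
    qed
    then have "p (x + y) - (q (x + s *\<^sub>R b) - s * d) \<le> p y" if "0 \<le> s" "b \<in> C" for s b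
      using that by (intro p_ge) (simp add: diff_le_eq add.commute)
    then have "p (x + y) - p y \<le> p x"
      by (intro p_ge) (simp add: diff_le_eq add.commute)
    then show "p (x + y) \<le> p x + p y" by simp
  next
    fix t :: real and x
    assume t: "0 \<le> t"
    show "p (t *\<^sub>R x) \<le> t * p x"
    proof (cases "t = 0")
      case True
      with p_le[of 0 c0 0] c0 sublinear_zero[OF q] show ?thesis by simp
    next
      case False
      with t have pos: "0 < t" by simp
      have "p (t *\<^sub>R x) / t \<le> p x"
      proof (rule p_ge)
        fix s :: real and c
        assume "0 \<le> s" "c \<in> C"
        then have "p (t *\<^sub>R x) \<le> q (t *\<^sub>R x + (t * s) *\<^sub>R c) - (t * s) * d"
          using t by (intro p_le) auto
        also have "t *\<^sub>R x + (t * s) *\<^sub>R c = t *\<^sub>R (x + s *\<^sub>R c)"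
          by (simp add: scaleR_add_right)
        also have "q \<dots> = t * q (x + s *\<^sub>R c)"
          by (rule sublinear_scaleR[OF q t])
        finally show "p (t *\<^sub>R x) / t \<le> q (x + s *\<^sub>R c) - s * d"
          using pos by (simp add: field_simps)
      qed
      with pos show ?thesis by (simp add: field_simps)
    qed
  qed
  moreover have "p \<le> q"
    using p_le[of 0 c0] c0 by (simp add: le_fun_def)
  moreover have "p (- c) \<le> - d" if "c \<in> C" for c
    using p_le[of 1 c "- c"] that sublinear_zero[OF q] by simp
  ultimately show ?thesis by (rule that)
qed

text \<open>
  Pushing \<open>m\<close> down along \<open>{y}\<close> by \<open>m y\<close> cannot change the minimal \<open>m\<close>, which forces
  \<open>m (- y) \<le> - m y\<close>. Then \<open>m\<close> is odd, so its subadditivity at \<open>- x\<close> and \<open>- y\<close> is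
  superadditivity at \<open>x\<close> and \<open>y\<close>.
\<close>

lemma minimal_sublinear_linear:
  fixes m :: "'a::real_vector \<Rightarrow> real"
  assumes m: "sublinear m" and min: "\<And>p. sublinear p \<Longrightarrow> p \<le> m \<Longrightarrow> p = m"
  shows "linear m"
proof -
  have neg: "m (- y) = - m y" for y
  proof -
    obtain p where "sublinear p" "p \<le> m" "p (- y) \<le> - m y"
      using sublinear_push_down[OF m, of "{y}" "m y"] by auto
    with min have "m (- y) \<le> - m y" by metis
    with sublinear_minus_le[OF m, of y] show ?thesis by simp
  qed
  have add: "m (x + y) = m x + m y" for x y
    using sublinear_add[OF m, of x y] sublinear_add[OF m, of "- x" "- y"] neg[of x] neg[of y]
      neg[of "x + y"] by simp
  have "m (t *\<^sub>R x) = t * m x" for t x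
  proof (cases "0 \<le> t")
    case False
    then have "m (- ((- t) *\<^sub>R x)) = - (- t * m x)"
      by (subst neg) (simp only: sublinear_scaleR[OF m])
    then show ?thesis by simp
  qed (simp add: sublinear_scaleR[OF m])
  with add show ?thesis by (intro linearI) auto
qed

text \<open>
  Pushing the norm down along \<open>K - a\<close> by the distance \<open>d\<close> from \<open>a\<close> to \<open>K\<close> and then minimising
  gives a linear functional of norm at most 1 that is at least \<open>d\<close> on \<open>K - a\<close>.
\<close>

lemma separate_point_closed_convex:
  fixes K :: "'a::real_normed_vector set"
  assumes "closed K" "convex K" "a \<notin> K"
  obtains f :: "'a \<Rightarrow> real" and b where "bounded_linear f" "b < f a" "\<And>x. x \<in> K \<Longrightarrow> f x \<le> b"
proof (cases "K = {}")
  case True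
  show ?thesis
    by (rule that[of "\<lambda>_. 0" "-1"]) (auto simp: True bounded_linear_zero)
next
  case False
  define d where "d = infdist a K"
  have d: "0 < d"
    unfolding d_def using assms False by (intro infdist_pos_not_in_closed)
  let ?C = "(\<lambda>k. k - a) ` K"
  have "convex ?C"
    using convex_translation[OF \<open>convex K\<close>, of "- a"] by simp
  moreover have "d \<le> norm c" if "c \<in> ?C" for c
    using that infdist_le[of _ K a] by (auto simp: d_def dist_norm norm_minus_commute)
  ultimately obtain p where p: "sublinear p" "p \<le> norm" "\<And>c. c \<in> ?C \<Longrightarrow> p (- c) \<le> - d"
    using sublinear_push_down[OF sublinear_norm, of ?C d] False by blast
  obtain m where m: "sublinear m" "m \<le> p" "\<And>p. sublinear p \<Longrightarrow> p \<le> m \<Longrightarrow> p = m"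
    using minimal_sublinear_exists[OF p(1)] by blast
  have lin: "linear m" using m by (intro minimal_sublinear_linear) auto
  have le: "m x \<le> norm x" for x
    using m(2) p(2) by (meson le_funD order_trans)
  have "norm (m x) \<le> norm x * 1" for x
    using le[of x] le[of "- x"] linear_neg[OF lin, of x] by simp
  then have bl: "bounded_linear m"
    using lin by (intro bounded_linear.intro bounded_linear_axioms.intro) blast+
  show ?thesis
  proof (rule that[of "\<lambda>x. - m x" "- m a - d"])
    fix k assume "k \<in> K"
    then have "m (- (k - a)) \<le> - d"
      using p(3) m(2) by (meson imageI le_funD order_trans)
    then show "- m k \<le> - m a - d"
      by (simp add: linear_diff[OF lin])
  qed (use bl d in \<open>auto intro: bounded_linear_minus\<close>)
qed


section \<open>Right-separated families in separable metric spaces\<close>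

text \<open>
  Choose a ball about \<open>x i\<close> missing \<open>G i\<close>, with rational radius and centre in the countable dense
  set \<open>D\<close>. Every later point \<open>x j\<close> lies in \<open>G i\<close>, hence outside the ball chosen for \<open>i\<close>, so
  different indices get different balls.
\<close>

lemma countable_right_separated:
  fixes x :: "'i::linorder \<Rightarrow> 'a::metric_space"
  assumes sep: "separable_space (euclidean :: 'a topology)"
    and G: "\<And>i. i \<in> I \<Longrightarrow> closed (G i)" "\<And>i. i \<in> I \<Longrightarrow> x i \<notin> G i"
    and later: "\<And>i j. i \<in> I \<Longrightarrow> j \<in> I \<Longrightarrow> i < j \<Longrightarrow> x j \<in> G i"
  shows "countable I"
proof -
  obtain D :: "'a set" where D: "countable D" "closure D = UNIV"
    using sep by (auto simp: separable_space_def)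
  have "\<exists>b \<in> D \<times> \<rat>. x i \<in> ball (fst b) (snd b) \<and> ball (fst b) (snd b) \<inter> G i = {}"
    if i: "i \<in> I" for i
  proof -
    have "open (- G i)" "x i \<in> - G i" using G[OF i] by auto
    then obtain e where e: "0 < e" "ball (x i) e \<subseteq> - G i"
      using open_contains_ball by blast
    obtain r where r: "r \<in> \<rat>" "0 < r" "r < e / 2"
      using Rats_dense_in_real[of 0 "e / 2"] e by auto
    obtain z where z: "z \<in> D" "dist z (x i) < r"
      using D(2) r(2) closure_approachable[of "x i" D] by auto
    have "ball z r \<subseteq> ball (x i) e"
    proof
      fix y assume "y \<in> ball z r"
      with z r dist_triangle[of "x i" y z] show "y \<in> ball (x i) e"
        by (simp add: dist_commute)
    qed
    with e z r show ?thesis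
      by (intro bexI[of _ "(z, r)"]) auto
  qed
  then obtain b where b: "\<And>i. i \<in> I \<Longrightarrow> b i \<in> D \<times> \<rat>"
    "\<And>i. i \<in> I \<Longrightarrow> x i \<in> ball (fst (b i)) (snd (b i))"
    "\<And>i. i \<in> I \<Longrightarrow> ball (fst (b i)) (snd (b i)) \<inter> G i = {}"
    by metis
  have ne: "b i \<noteq> b j" if "i \<in> I" "j \<in> I" "i < j" for i j
    using b(2)[OF that(2)] b(3)[OF that(1)] later[OF that] by auto
  have "inj_on b I"
    by (rule inj_onI) (metis ne linorder_neqE)
  moreover have "countable (b ` I)"
    using b(1) D(1) countable_rat
    by (intro countable_subset[of "b ` I" "D \<times> \<rat>"] image_subsetI countable_SIGMA)
  ultimately show ?thesis
    using countable_image_inj_on by blast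
qed


section \<open>Monotonicity of the derivation\<close>

lemma small_trace_mono:
  assumes "bounded (V \<inter> D) \<and> diameter (V \<inter> D) < \<epsilon>" "U \<subseteq> V" "C \<subseteq> D" "\<epsilon> \<le> \<epsilon>'"
  shows "bounded (U \<inter> C) \<and> diameter (U \<inter> C) < \<epsilon>'"
proof -
  have "U \<inter> C \<subseteq> V \<inter> D" using assms by blast
  with assms show ?thesis
    using diameter_subset[of "U \<inter> C" "V \<inter> D"] bounded_subset[of "V \<inter> D" "U \<inter> C"] by linarith
qed

lemma sigma1_mono:
  assumes "C \<subseteq> D" "\<epsilon>' \<le> \<epsilon>"
  shows "sigma1 \<epsilon> C \<subseteq> sigma1 \<epsilon>' D"
  using small_trace_mono[OF _ order_refl assms] assms(1) unfolding sigma1_def by blast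

lemma gamma1_mono:
  assumes "C \<subseteq> D" "\<epsilon>' \<le> \<epsilon>"
  shows "gamma1 \<epsilon> C \<subseteq> gamma1 \<epsilon>' D"
  unfolding gamma1_def by (intro closure_mono hull_mono sigma1_mono assms)

lemma gamma1_minimal:
  assumes "sigma1 \<epsilon> C \<subseteq> D" "closed D" "convex D"
  shows "gamma1 \<epsilon> C \<subseteq> D"
  unfolding gamma1_def by (intro closure_minimal hull_minimal assms)

lemma gamma1_subset: "closed C \<Longrightarrow> convex C \<Longrightarrow> gamma1 \<epsilon> C \<subseteq> C"
  by (rule gamma1_minimal) (auto simp: sigma1_def)

lemma gamma_iter_induct [case_names zero succ limit]:
  fixes \<alpha> :: "'o::wellorder"
  assumes zero: "\<And>\<alpha>. is_zero_ord \<alpha> \<Longrightarrow> P \<alpha>"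
    and succ: "\<And>\<alpha> \<beta>. is_succ_of \<alpha> \<beta> \<Longrightarrow> P \<beta> \<Longrightarrow> P \<alpha>"
    and limit: "\<And>\<alpha>. \<not> is_zero_ord \<alpha> \<Longrightarrow> \<nexists>\<beta>. is_succ_of \<alpha> \<beta> \<Longrightarrow> (\<And>\<beta>. \<beta> < \<alpha> \<Longrightarrow> P \<beta>) \<Longrightarrow> P \<alpha>"
  shows "P \<alpha>"
proof (induction \<alpha> rule: less_induct)
  case (less \<alpha>)
  then show ?case
    using zero succ limit unfolding is_succ_of_def by metis
qed

lemma closed_convex_gamma_iter:
  assumes "closed C" "convex C"
  shows "closed (gamma_iter \<epsilon> C \<alpha>) \<and> convex (gamma_iter \<epsilon> C \<alpha>)"
proof (induction \<alpha> rule: gamma_iter_induct)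
  case (succ \<alpha> \<beta>)
  then show ?case
    by (simp add: gamma_iter_succ gamma1_def)
next
  case (limit \<alpha>)
  then show ?case
    by (auto simp: gamma_iter_limit intro!: convex_INT)
qed (simp add: gamma_iter_zero assms)

lemma gamma_iter_antimono:
  assumes "closed C" "convex C" "\<beta> \<le> \<alpha>"
  shows "gamma_iter \<epsilon> C \<alpha> \<subseteq> gamma_iter \<epsilon> C \<beta>"
  using \<open>\<beta> \<le> \<alpha>\<close>
proof (induction \<alpha> rule: gamma_iter_induct)
  case (zero \<alpha>)
  then have "\<beta> = \<alpha>" unfolding is_zero_ord_def by (meson order_antisym)
  then show ?case by simp
next
  case (succ \<alpha> \<delta>)
  show ?case
  proof (cases "\<beta> = \<alpha>")
    case False
    with succ have "\<beta> \<le> \<delta>" unfolding is_succ_of_def by (meson leD leI order_antisym)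
    then have "gamma_iter \<epsilon> C \<delta> \<subseteq> gamma_iter \<epsilon> C \<beta>" by (rule succ.IH)
    moreover have "gamma1 \<epsilon> (gamma_iter \<epsilon> C \<delta>) \<subseteq> gamma_iter \<epsilon> C \<delta>"
      using closed_convex_gamma_iter[OF assms(1,2)] by (intro gamma1_subset) auto
    ultimately show ?thesis by (simp add: gamma_iter_succ[OF succ.hyps])
  qed simp
next
  case (limit \<alpha>)
  then show ?case by (cases "\<beta> = \<alpha>") (auto simp: gamma_iter_limit)
qed

lemma gamma_iter_mono_eps:
  assumes "\<epsilon>' \<le> \<epsilon>"
  shows "gamma_iter \<epsilon> C \<alpha> \<subseteq> gamma_iter \<epsilon>' C \<alpha>"
proof (induction \<alpha> rule: gamma_iter_induct)
  case (succ \<alpha> \<beta>)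
  then show ?case by (simp add: gamma_iter_succ gamma1_mono assms)
next
  case (limit \<alpha>)
  then show ?case by (fastforce simp: gamma_iter_limit)
qed (simp add: gamma_iter_zero)

text \<open>
  The intersection taken at a limit stage cannot lose \<open>A\<close> for the first time, so the first loss
  happens in a single application of \<open>\<gamma>\<^sup>1\<close>.
\<close>

lemma first_loss_of_gamma_iter:
  fixes \<alpha> :: "'o::wellorder"
  assumes "A \<subseteq> C" "\<not> A \<subseteq> gamma_iter \<epsilon> C \<alpha>"
  obtains \<beta> :: 'o where "A \<subseteq> gamma_iter \<epsilon> C \<beta>" "\<not> A \<subseteq> gamma1 \<epsilon> (gamma_iter \<epsilon> C \<beta>)"
proof -
  have "(\<exists>\<beta>::'o. A \<subseteq> gamma_iter \<epsilon> C \<beta> \<and> \<not> A \<subseteq> gamma1 \<epsilon> (gamma_iter \<epsilon> C \<beta>)) \<or> A \<subseteq> gamma_iter \<epsilon> C \<alpha>"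
  proof (induction \<alpha> rule: gamma_iter_induct)
    case (succ \<alpha> \<beta>)
    then show ?case by (auto simp: gamma_iter_succ)
  next
    case (limit \<alpha>)
    then show ?case unfolding gamma_iter_limit[OF limit.hyps] by blast
  qed (simp add: gamma_iter_zero assms)
  with assms that show ?thesis by blast
qed


section \<open>From the index to the Slice PCP\<close>

lemma slice_of_subset_avoiding_gamma1:
  fixes A C :: "'a::real_normed_vector set"
  assumes "A \<subseteq> C" "\<not> A \<subseteq> gamma1 \<epsilon> C"
  obtains S where "open_half_space S" "S \<inter> A \<noteq> {}"
    "\<And>x. x \<in> S \<inter> A \<Longrightarrow> \<exists>V. openin weak_top V \<and> x \<in> V \<and> diameter (V \<inter> A) < \<epsilon>"
proof -
  obtain a where a: "a \<in> A" "a \<notin> gamma1 \<epsilon> C" using assms by blast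
  have "closed (gamma1 \<epsilon> C)" "convex (gamma1 \<epsilon> C)"
    by (simp_all add: gamma1_def)
  then obtain f :: "'a \<Rightarrow> real" and b
    where f: "bounded_linear f" "b < f a" "\<And>x. x \<in> gamma1 \<epsilon> C \<Longrightarrow> f x \<le> b"
    using separate_point_closed_convex[of "gamma1 \<epsilon> C" a, OF _ _ a(2)] by metis
  have "sigma1 \<epsilon> C \<subseteq> gamma1 \<epsilon> C"
    unfolding gamma1_def using hull_subset closure_subset by fast
  show ?thesis
  proof (rule that[of "{x. b < f x}"])
    show "open_half_space {x. b < f x}"
      using f by (auto simp: open_half_space_def)
    show "{x. b < f x} \<inter> A \<noteq> {}" using a f by auto
    fix x assume x: "x \<in> {x. b < f x} \<inter> A"
    with f(3) \<open>sigma1 \<epsilon> C \<subseteq> gamma1 \<epsilon> C\<close> have "x \<notin> sigma1 \<epsilon> C" by fastforce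
    with x assms obtain V where V: "openin weak_top V" "x \<in> V"
      "bounded (V \<inter> C) \<and> diameter (V \<inter> C) < \<epsilon>"
      unfolding sigma1_def by blast
    with small_trace_mono[OF V(3) order_refl assms(1) order_refl]
    show "\<exists>V. openin weak_top V \<and> x \<in> V \<and> diameter (V \<inter> A) < \<epsilon>" by blast
  qed
qed

lemma topspace_weak_top [simp]: "topspace weak_top = (UNIV :: 'a::real_normed_vector set)"
proof -
  have "UNIV = (\<lambda>x::'a. 0::real) -` UNIV" by simp
  then have "UNIV \<in> {f -` U | (f :: 'a \<Rightarrow> real) U. bounded_linear f \<and> open U}"
    using bounded_linear_zero open_UNIV by blast
  then show ?thesis
    unfolding weak_top_def topology_generated_by_topspace by blast
qed

lemma openin_weak_top_vimage_scaleR: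
  fixes V :: "'a::real_normed_vector set"
  assumes "openin weak_top V"
  shows "openin weak_top ((*\<^sub>R) c -` V)"
proof -
  have "continuous_map weak_top weak_top ((*\<^sub>R) c :: 'a \<Rightarrow> 'a)"
    unfolding weak_top_def[where 'a = 'a, abs_def]
  proof (rule continuous_on_generated_topo, goal_cases)
    case (1 W)
    then obtain f :: "'a \<Rightarrow> real" and U where W: "W = f -` U" "bounded_linear f" "open U" by blast
    have "bounded_linear (\<lambda>x. f (c *\<^sub>R x))"
      using W(2) bounded_linear_scaleR_right by (rule bounded_linear_compose)
    moreover have "(*\<^sub>R) c -` W = (\<lambda>x. f (c *\<^sub>R x)) -` U" using W by auto
    ultimately show ?case
      using W(3) topspace_weak_top[where 'a = 'a] unfolding weak_top_def
      by (auto intro!: topology_generated_by_Basis)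
  next
    case 2
    show ?case
      using topspace_weak_top[where 'a = 'a]
      unfolding weak_top_def topology_generated_by_topspace by simp
  qed
  with assms show ?thesis
    by (auto simp: continuous_map_alt)
qed

lemma open_half_space_vimage_scaleR:
  fixes S :: "'a::real_normed_vector set"
  assumes "open_half_space S"
  shows "open_half_space ((*\<^sub>R) c -` S)"
proof -
  obtain f :: "'a \<Rightarrow> real" and b where f: "bounded_linear f" "S = {x. b < f x}"
    using assms by (auto simp: open_half_space_def)
  have "bounded_linear (\<lambda>x. f (c *\<^sub>R x))"
    using f(1) bounded_linear_scaleR_right by (rule bounded_linear_compose)
  with f(2) show ?thesis by (auto simp: open_half_space_def)
qed

text \<open>
  Half-spaces and weakly open sets pull back under the homothety that shrinks \<open>A\<close> into the unit
  ball, so the slice found for the image of \<open>A\<close> gives one for \<open>A\<close>, with diameters multiplied by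
  \<open>r\<close>.
\<close>

lemma slice_PCP_if_gamma_iter_vanishes:
  assumes van: "\<And>\<epsilon>. 0 < \<epsilon> \<Longrightarrow> \<exists>\<alpha>::'o::wellorder. gamma_iter \<epsilon> (cball (0::'a::real_normed_vector) 1) \<alpha> = {}"
  shows "slice_PCP TYPE('a)"
  unfolding slice_PCP_def
proof (intro allI impI)
  fix A :: "'a set" and \<epsilon> :: real
  assume A: "A \<noteq> {}" "bounded A" and \<epsilon>: "0 < \<epsilon>"
  obtain r where r: "0 < r" "\<And>x. x \<in> A \<Longrightarrow> norm x \<le> r"
    using A(2) by (auto simp: bounded_pos)
  let ?c = "inverse r" and ?B = "cball (0::'a) 1"
  let ?A = "(*\<^sub>R) ?c ` A"
  \<comment> \<open>With half of \<open>\<epsilon>\<close> to spare, bounding all distances by \<open>\<epsilon> / 2\<close> gives a diameter below \<open>\<epsilon>\<close>.\<close>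
  obtain \<alpha> :: 'o where "gamma_iter (\<epsilon> / (2 * r)) ?B \<alpha> = {}"
    using van[of "\<epsilon> / (2 * r)"] \<epsilon> r(1) by auto
  moreover have "?A \<subseteq> ?B"
    using r by (auto simp: field_simps)
  ultimately obtain \<beta> :: 'o where "?A \<subseteq> gamma_iter (\<epsilon> / (2 * r)) ?B \<beta>"
    "\<not> ?A \<subseteq> gamma1 (\<epsilon> / (2 * r)) (gamma_iter (\<epsilon> / (2 * r)) ?B \<beta>)"
    using first_loss_of_gamma_iter[of ?A ?B "\<epsilon> / (2 * r)" \<alpha>] A(1)
    by (metis image_is_empty subset_empty)
  then obtain S where S: "open_half_space S" "S \<inter> ?A \<noteq> {}"
    "\<And>x. x \<in> S \<inter> ?A \<Longrightarrow> \<exists>V. openin weak_top V \<and> x \<in> V \<and> diameter (V \<inter> ?A) < \<epsilon> / (2 * r)"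
    by (rule slice_of_subset_avoiding_gamma1) blast
  show "\<exists>S. open_half_space S \<and> S \<inter> A \<noteq> {} \<and>
          (\<forall>x\<in>S \<inter> A. \<exists>V. weak_nhd x V \<and> diameter (V \<inter> A) < \<epsilon>)"
  proof (rule exI[of _ "(*\<^sub>R) ?c -` S"], intro conjI ballI)
    show "open_half_space ((*\<^sub>R) ?c -` S)"
      by (rule open_half_space_vimage_scaleR[OF S(1)])
    show "(*\<^sub>R) ?c -` S \<inter> A \<noteq> {}" using S(2) by auto
    fix x assume "x \<in> (*\<^sub>R) ?c -` S \<inter> A"
    then obtain V where V: "openin weak_top V" "?c *\<^sub>R x \<in> V" "diameter (V \<inter> ?A) < \<epsilon> / (2 * r)"
      using S(3)[of "?c *\<^sub>R x"] by auto
    let ?V = "(*\<^sub>R) ?c -` V"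
    have "weak_nhd x ?V"
      using openin_weak_top_vimage_scaleR[OF V(1)] V(2) by (auto simp: weak_nhd_def)
    moreover have "diameter (?V \<inter> A) \<le> \<epsilon> / 2"
    proof (rule diameter_le)
      fix y z assume yz: "y \<in> ?V \<inter> A" "z \<in> ?V \<inter> A"
      have "bounded (V \<inter> ?A)"
        using A(2) bounded_scaling by (intro bounded_Int) auto
      then have "dist (?c *\<^sub>R y) (?c *\<^sub>R z) \<le> diameter (V \<inter> ?A)"
        using yz by (intro diameter_bounded_bound) auto
      moreover have "dist (?c *\<^sub>R y) (?c *\<^sub>R z) = norm (y - z) / r"
        using r(1) by (simp add: dist_norm scaleR_diff_right[symmetric] divide_inverse mult.commute)
      ultimately have "norm (y - z) / r < \<epsilon> / (2 * r)"
        using V(3) by linarith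
      then show "norm (y - z) \<le> \<epsilon> / 2"
        using r(1) by (simp add: field_simps)
    qed (use \<epsilon> in simp)
    ultimately show "\<exists>V. weak_nhd x V \<and> diameter (V \<inter> A) < \<epsilon>"
      using \<epsilon> by (intro exI[of _ ?V]) auto
  qed
qed


section \<open>From the Slice PCP to the index\<close>

lemma gamma1_psubset:
  fixes C :: "'a::real_normed_vector set"
  assumes "slice_PCP TYPE('a)" and C: "C \<noteq> {}" "bounded C" "closed C" "convex C" and "0 < \<epsilon>"
  shows "gamma1 \<epsilon> C \<subset> C"
proof -
  obtain S where S: "open_half_space S" "S \<inter> C \<noteq> {}"
    "\<And>x. x \<in> S \<inter> C \<Longrightarrow> \<exists>V. weak_nhd x V \<and> diameter (V \<inter> C) < \<epsilon>"
    using assms(1)[unfolded slice_PCP_def, rule_format, OF C(1,2) \<open>0 < \<epsilon>\<close>] by metis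
  have "S \<inter> sigma1 \<epsilon> C = {}"
  proof -
    have "x \<notin> sigma1 \<epsilon> C" if "x \<in> S" "x \<in> C" for x
    proof -
      obtain V U where V: "diameter (V \<inter> C) < \<epsilon>" and U: "openin weak_top U" "x \<in> U" "U \<subseteq> V"
        using S(3)[of x] \<open>x \<in> S\<close> \<open>x \<in> C\<close> unfolding weak_nhd_def by auto
      have "bounded (V \<inter> C) \<and> diameter (V \<inter> C) < \<epsilon>" using C(2) V by (simp add: bounded_Int)
      from small_trace_mono[OF this U(3) order_refl order_refl] U that show ?thesis
        unfolding sigma1_def by blast
    qed
    then show ?thesis by (auto simp: sigma1_def)
  qed
  moreover obtain f :: "'a \<Rightarrow> real" and b where f: "bounded_linear f" "S = {x. b < f x}"
    using S(1) by (auto simp: open_half_space_def)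
  ultimately have "sigma1 \<epsilon> C \<subseteq> {x. f x \<le> b}" by force
  moreover have "closed {x. f x \<le> b}"
    using f(1) by (intro closed_Collect_le continuous_intros linear_continuous_on)
  moreover have "convex {x. f x \<le> b}"
    using convex_linear_vimage[OF bounded_linear.linear[OF f(1)], of "{..b}"] by (simp add: vimage_def)
  ultimately have "gamma1 \<epsilon> C \<subseteq> {x. f x \<le> b}" by (rule gamma1_minimal)
  with S(2) f(2) gamma1_subset[OF C(3,4), of \<epsilon>] show ?thesis by fastforce
qed

lemma ex_succ_below:
  fixes \<alpha> :: "'o::wellorder"
  assumes "\<alpha> < \<kappa>"
  obtains \<alpha>' where "is_succ_of \<alpha>' \<alpha>"
proof
  show "is_succ_of (LEAST \<delta>. \<alpha> < \<delta>) \<alpha>"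
    unfolding is_succ_of_def using LeastI[of "\<lambda>\<delta>. \<alpha> < \<delta>", OF assms] by (auto intro: Least_le)
qed

text \<open>
  As long as the derived sets are nonempty, each loses a point to the next one; these points form a
  right-separated family, which cannot be uncountable.
\<close>

lemma gamma_iter_vanishes_below:
  fixes C :: "'a::real_normed_vector set" and \<kappa> :: "'o::wellorder"
  assumes sep: "separable_space (euclidean :: 'a topology)" and PCP: "slice_PCP TYPE('a)"
    and C: "bounded C" "closed C" "convex C" and \<epsilon>: "0 < \<epsilon>" and unc: "uncountable {..<\<kappa>}"
  shows "\<exists>\<alpha><\<kappa>. gamma_iter \<epsilon> C \<alpha> = {}"
proof (rule ccontr)
  assume "\<not> ?thesis"
  then have ne: "gamma_iter \<epsilon> C \<alpha> \<noteq> {}" if "\<alpha> < \<kappa>" for \<alpha> using that by blast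
  have cc: "closed (gamma_iter \<epsilon> C \<alpha>)" "convex (gamma_iter \<epsilon> C \<alpha>)" for \<alpha> :: 'o
    using closed_convex_gamma_iter[OF C(2,3)] by auto
  define G where "G \<alpha> = gamma1 \<epsilon> (gamma_iter \<epsilon> C \<alpha>)" for \<alpha> :: 'o
  have bdd: "bounded (gamma_iter \<epsilon> C \<alpha>)" for \<alpha> :: 'o
  proof -
    obtain z :: 'o where z: "is_zero_ord z"
      unfolding is_zero_ord_def by (meson Least_le UNIV_I)
    then have "gamma_iter \<epsilon> C \<alpha> \<subseteq> C"
      using gamma_iter_antimono[OF C(2,3), of z \<alpha> \<epsilon>] by (auto simp: gamma_iter_zero is_zero_ord_def)
    with C(1) show ?thesis using bounded_subset by blast
  qed
  have "\<exists>x. x \<in> gamma_iter \<epsilon> C \<alpha> \<and> x \<notin> G \<alpha>" if "\<alpha> < \<kappa>" for \<alpha>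
    using gamma1_psubset[OF PCP ne[OF that] bdd cc \<epsilon>] unfolding G_def by blast
  then obtain x where x: "\<And>\<alpha>. \<alpha> < \<kappa> \<Longrightarrow> x \<alpha> \<in> gamma_iter \<epsilon> C \<alpha>" "\<And>\<alpha>. \<alpha> < \<kappa> \<Longrightarrow> x \<alpha> \<notin> G \<alpha>"
    by metis
  have later: "x \<beta> \<in> G \<alpha>" if "\<alpha> < \<beta>" "\<beta> < \<kappa>" for \<alpha> \<beta>
  proof -
    obtain \<alpha>' where \<alpha>': "is_succ_of \<alpha>' \<alpha>" using ex_succ_below[OF \<open>\<alpha> < \<beta>\<close>] by blast
    with \<open>\<alpha> < \<beta>\<close> have "gamma_iter \<epsilon> C \<beta> \<subseteq> gamma_iter \<epsilon> C \<alpha>'"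
      by (intro gamma_iter_antimono C) (simp add: is_succ_of_def)
    with x(1)[OF \<open>\<beta> < \<kappa>\<close>] show ?thesis
      unfolding G_def gamma_iter_succ[OF \<alpha>', symmetric] by blast
  qed
  have "countable {..<\<kappa>}"
  proof (rule countable_right_separated[OF sep])
    show "closed (G \<alpha>)" for \<alpha> by (simp add: G_def gamma1_def)
  qed (use x later in auto)
  with unc show False by blast
qed

lemma countable_bounded_below_omega_one:
  fixes \<alpha> :: "nat \<Rightarrow> ('a \<times> real) ordinal"
  assumes "\<And>n. \<alpha> n < omega_one"
  obtains \<beta> where "\<beta> < omega_one" "\<And>n. \<alpha> n \<le> \<beta>"
proof -
  have "countable (\<Union>n. {..<\<alpha> n})"
    using assms by (auto simp: less_omega_one_iff)
  then have "\<not> {..<omega_one} \<subseteq> (\<Union>n. {..<\<alpha> n})"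
    using uncountable_below_omega_one countable_subset by blast
  then obtain \<beta> where "\<beta> < omega_one" "\<And>n. \<not> \<beta> < \<alpha> n" by auto
  with that show ?thesis by (meson leI)
qed


section \<open>The characterisation\<close>

text \<open>
  The infimum in the index is attained because ordinals are well-ordered, and an empty index set
  gives infinity, which lies above every ordinal.
\<close>

lemma C_index_eps_le_iff:
  "C_index_eps TYPE('a::real_normed_vector) \<epsilon> \<le> Ord \<beta> \<longleftrightarrow>
     (\<exists>\<alpha>\<le>\<beta>. gamma_iter \<epsilon> (cball (0::'a) 1) \<alpha> = {})"
proof -
  let ?Z = "{\<alpha> :: ('a \<times> real) ordinal. gamma_iter \<epsilon> (cball (0::'a) 1) \<alpha> = {}}"
  show ?thesis
  proof
    assume L: "C_index_eps TYPE('a) \<epsilon> \<le> Ord \<beta>"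
    show "\<exists>\<alpha>\<le>\<beta>. gamma_iter \<epsilon> (cball (0::'a) 1) \<alpha> = {}"
    proof (rule ccontr)
      assume none: "\<not> ?thesis"
      have "Ord -` Ord ` ?Z \<noteq> {}"
        using L by (auto simp: C_index_eps_def Inf_with_infty_def split: if_splits)
      then obtain \<alpha> where \<alpha>: "\<alpha> \<in> ?Z" by auto
      have "C_index_eps TYPE('a) \<epsilon> = Ord (LEAST \<alpha>. \<alpha> \<in> ?Z)"
        using \<alpha> by (auto simp: C_index_eps_def Inf_with_infty_def image_iff)
      with L have "(LEAST \<alpha>. \<alpha> \<in> ?Z) \<le> \<beta>" by simp
      moreover have "(LEAST \<alpha>. \<alpha> \<in> ?Z) \<in> ?Z" using \<alpha> by (rule LeastI)
      ultimately show False using none by blast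
    qed
  next
    assume "\<exists>\<alpha>\<le>\<beta>. gamma_iter \<epsilon> (cball (0::'a) 1) \<alpha> = {}"
    then obtain \<alpha> where \<alpha>: "\<alpha> \<le> \<beta>" "\<alpha> \<in> ?Z" by blast
    then have "C_index_eps TYPE('a) \<epsilon> \<le> Ord \<alpha>"
      unfolding C_index_eps_def by (intro Inf_lower imageI)
    also have "\<dots> \<le> Ord \<beta>" using \<alpha> by simp
    finally show "C_index_eps TYPE('a) \<epsilon> \<le> Ord \<beta>" .
  qed
qed

theorem proposition2p6:
  assumes "separable_space (euclidean :: 'a::banach topology)"
  shows "C_index TYPE('a) < Ord omega_one \<longleftrightarrow> slice_PCP TYPE('a)"
proof
  assume "C_index TYPE('a) < Ord omega_one"
  then obtain \<beta> where \<beta>: "C_index TYPE('a) = Ord \<beta>"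
    by (cases "C_index TYPE('a)") (auto simp: less_with_infty_def)
  have "\<exists>\<alpha> :: ('a \<times> real) ordinal. gamma_iter \<epsilon> (cball (0::'a) 1) \<alpha> = {}" if "0 < \<epsilon>" for \<epsilon>
  proof -
    have "C_index_eps TYPE('a) \<epsilon> \<le> Ord \<beta>"
      unfolding \<beta>[symmetric] C_index_def using that by (intro SUP_upper) simp
    then show ?thesis using C_index_eps_le_iff by blast
  qed
  then show "slice_PCP TYPE('a)" by (rule slice_PCP_if_gamma_iter_vanishes)
next
  assume PCP: "slice_PCP TYPE('a)"
  let ?B = "cball (0::'a) 1"
  have "\<exists>\<alpha> < omega_one :: ('a \<times> real) ordinal. gamma_iter (inverse (real (Suc n))) ?B \<alpha> = {}" for n
    using assms PCP uncountable_below_omega_one by (intro gamma_iter_vanishes_below) auto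
  then obtain \<alpha> :: "nat \<Rightarrow> ('a \<times> real) ordinal" where \<alpha>: "\<And>n. \<alpha> n < omega_one"
    "\<And>n. gamma_iter (inverse (real (Suc n))) ?B (\<alpha> n) = {}" by metis
  obtain \<beta> where \<beta>: "\<beta> < omega_one" "\<And>n. \<alpha> n \<le> \<beta>"
    using countable_bounded_below_omega_one[of \<alpha>] \<alpha>(1) by blast
  have "C_index_eps TYPE('a) \<epsilon> \<le> Ord \<beta>" if "0 < \<epsilon>" for \<epsilon>
  proof -
    obtain n where "inverse (real (Suc n)) < \<epsilon>" using reals_Archimedean[OF \<open>0 < \<epsilon>\<close>] by auto
    then have "gamma_iter \<epsilon> ?B (\<alpha> n) = {}"
      using gamma_iter_mono_eps[of "inverse (real (Suc n))" \<epsilon> ?B "\<alpha> n"] \<alpha>(2)[of n] by simp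
    then show ?thesis using \<beta>(2) C_index_eps_le_iff by blast
  qed
  then have "C_index TYPE('a) \<le> Ord \<beta>"
    unfolding C_index_def by (intro SUP_least) simp
  also have "\<dots> < Ord omega_one" using \<beta>(1) by simp
  finally show "C_index TYPE('a) < Ord omega_one" .
qed

end
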